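(* Let $(X,d)$ be a metric space with $|X|\geq 2$. Then the following statements are equivalent: (i) The metric space $(X,d)$ is ultrametric. (ii) The graph $G_{X,d}^{r}$ is either empty or complete multipartite for every $r\in(0,\operatorname{diam} X]$.
   Context: Graphs are simple: a graph $G=(V,E)$ consists of a nonempty set $V=V(G)$ of arbitrary cardinality and a set $E=E(G)$ of unordered pairs of distinct points of $V$. A graph is empty if $E(G)=\varnothing$. For a cardinal number $k\geq 2$, $G$ is complete $k$-partite if $V(G)$ can be partitioned into $k$ nonempty disjoint subsets (parts) such that no edge has both ends in the same part and any two vertices in different parts are adjacent; $G$ is complete multipartite if it is complete $k$-partite for some cardinal $k \geq 2$ (finite or infinite). For a metric space $(X,d)$, $\operatorname{diam} X=\sup\{d(x,y):x,y\in X\}\in[0,\infty]$; if $\operatorname{diam} X=\infty$, then $(0,\operatorname{diam}X]=(0,\infty]$ includes $\infty$. For $r\in(0,\infty]$, $G_{X,d}^{r}$ is the graph with vertex set $X$ in which, for distinct $u,v\in X$, $\{u,v\}$ is an edge iff $d(u,v)\geq r$ (so $G^{\infty}_{X,d}$ has no edges). A metric space is ultrametric if $d(x,y)\leq\max\{d(x,z),d(z,y)\}$ for all $x,y,z\in X$. *)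

theory Defs
  imports
    "HOL-Library.Disjoint_Sets"
    "HOL-Library.Extended_Real"
    "HOL-Analysis.Abstract_Metric_Spaces"
begin

unbundle cardinal_syntax

record 'a ugraph =
  verts :: "'a set"
  edges :: "'a set set"

definition simple_graph :: "'a ugraph \<Rightarrow> bool" where
  "simple_graph G \<longleftrightarrow>
     verts G \<noteq> {} \<and>
     edges G \<subseteq> {{u, v} | u v. u \<in> verts G \<and> v \<in> verts G \<and> u \<noteq> v}"

definition empty_graph :: "'a ugraph \<Rightarrow> bool" where
  "empty_graph G \<longleftrightarrow> edges G = {}"

text \<open>Cardinal numbers are represented, as usual, by cardinal orders; \<open>k\<close> may be infinite.\<close>

definition complete_partite :: "'k rel \<Rightarrow> 'a ugraph \<Rightarrow> bool" where
  "complete_partite k G \<longleftrightarrow>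
     Card_order k \<and> ctwo \<le>o k \<and>
     (\<exists>P. partition_on (verts G) P \<and> |P| =o k \<and>
        (\<forall>A\<in>P. \<forall>u\<in>A. \<forall>v\<in>A. {u, v} \<notin> edges G) \<and>
        (\<forall>A\<in>P. \<forall>B\<in>P. A \<noteq> B \<longrightarrow> (\<forall>u\<in>A. \<forall>v\<in>B. {u, v} \<in> edges G)))"

text \<open>
  The parts form a set of sets of vertices, so the cardinal orders on the type of sets of
  vertices cover every possible number of parts; see \<open>complete_partite_imp_multipartite\<close>.
\<close>

definition complete_multipartite :: "'a ugraph \<Rightarrow> bool" where
  "complete_multipartite G \<longleftrightarrow> (\<exists>k :: 'a set rel. complete_partite k G)"

lemma complete_partite_imp_multipartite:
  fixes k :: "'k rel" and G :: "'a ugraph"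
  assumes "complete_partite k G"
  shows "complete_multipartite G"
proof -
  from assms obtain P where k: "ctwo \<le>o k" and P: "partition_on (verts G) P" "|P| =o k"
    "(\<forall>A\<in>P. \<forall>u\<in>A. \<forall>v\<in>A. {u, v} \<notin> edges G) \<and>
     (\<forall>A\<in>P. \<forall>B\<in>P. A \<noteq> B \<longrightarrow> (\<forall>u\<in>A. \<forall>v\<in>B. {u, v} \<in> edges G))"
    unfolding complete_partite_def by auto
  have "ctwo \<le>o |P|"
    by (rule ordLeq_ordIso_trans[OF k ordIso_symmetric[OF P(2)]])
  then have "complete_partite |P| G"
    unfolding complete_partite_def
    by (intro conjI exI[of _ P] P(1) card_of_Card_order card_of_refl
        conjunct1[OF P(3)] conjunct2[OF P(3)])
  then show ?thesis
    unfolding complete_multipartite_def by (rule exI)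
qed

text \<open>The diameter is extended-real-valued, so that unbounded spaces have diameter \<open>\<infinity>\<close>.\<close>

definition ediam :: "'a set \<Rightarrow> ('a \<Rightarrow> 'a \<Rightarrow> real) \<Rightarrow> ereal" where
  "ediam X d = (SUP (x, y) \<in> X \<times> X. ereal (d x y))"

definition dist_graph :: "'a set \<Rightarrow> ('a \<Rightarrow> 'a \<Rightarrow> real) \<Rightarrow> ereal \<Rightarrow> 'a ugraph" where
  "dist_graph X d r =
     \<lparr>verts = X, edges = {{u, v} | u v. u \<in> X \<and> v \<in> X \<and> u \<noteq> v \<and> ereal (d u v) \<ge> r}\<rparr>"

lemma simple_graph_dist_graph: "X \<noteq> {} \<Longrightarrow> simple_graph (dist_graph X d r)"
  unfolding simple_graph_def dist_graph_def by auto

lemma dist_graph_adjacent_iff: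
  assumes "Metric_space X d" "u \<in> X" "v \<in> X" "u \<noteq> v"
  shows "{u, v} \<in> edges (dist_graph X d r) \<longleftrightarrow> ereal (d u v) \<ge> r"
  using assms by (auto simp: dist_graph_def doubleton_eq_iff Metric_space.commute)

definition ultrametric_space :: "'a set \<Rightarrow> ('a \<Rightarrow> 'a \<Rightarrow> real) \<Rightarrow> bool" where
  "ultrametric_space X d \<longleftrightarrow>
     Metric_space X d \<and> (\<forall>x\<in>X. \<forall>y\<in>X. \<forall>z\<in>X. d x y \<le> max (d x z) (d z y))"

end

theory Submission imports Defs begin

text \<open>
  Non-adjacency in a complete multipartite graph is the equivalence relation ``same part''. In
  \<open>dist_graph X d r\<close>, non-adjacency is \<open>d x y < r\<close>, and transitivity of this relation for all
  relevant \<open>r\<close> is the ultrametric inequality: a failure \<open>max (d x z) (d z y) < d x y\<close> is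
  detected at \<open>r = d x y\<close>.
\<close>

lemma ctwo_ordLeq_card_ofI:
  assumes "a \<in> A" "b \<in> A" "a \<noteq> b"
  shows "ctwo \<le>o |A|"
  \<comment> \<open>\<open>ctwo\<close> is the cardinality of \<open>bool\<close>, so two distinct
    elements of \<open>A\<close> give the required injection from the truth values.\<close>
  unfolding ctwo_def card_of_ordLeq[symmetric]
  by (rule exI[of _ "\<lambda>t. if t then a else b"]) (use assms in \<open>auto simp: inj_on_def\<close>)

text \<open>The classes of \<open>R\<close> serve as the parts, and their own cardinality as
  \<open>k\<close>. The unrelated pair \<open>u\<close>, \<open>v\<close> yields two different
  classes, which secures at least two parts.\<close>

lemma complete_multipartiteI:
  assumes R: "equiv (verts G) R"
    and uv: "u \<in> verts G" "v \<in> verts G" "(u, v) \<notin> R"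
    and edge_iff: "\<And>x y. x \<in> verts G \<Longrightarrow> y \<in> verts G \<Longrightarrow> {x, y} \<in> edges G \<longleftrightarrow> (x, y) \<notin> R"
  shows "complete_multipartite G"
proof -
  let ?P = "verts G // R"
  have "ctwo \<le>o |?P|"
  proof (rule ctwo_ordLeq_card_ofI)
    show "R `` {u} \<in> ?P" "R `` {v} \<in> ?P" using uv by (auto intro: quotientI)
    show "R `` {u} \<noteq> R `` {v}" using uv R by (simp add: eq_equiv_class_iff)
  qed
  moreover have "partition_on (verts G) ?P" by (rule partition_on_quotient[OF R])
  moreover have "{x, y} \<notin> edges G" if "A \<in> ?P" "x \<in> A" "y \<in> A" for A x y
  proof -
    have "x \<in> verts G" "y \<in> verts G" using in_quotient_imp_subset[OF R that(1)] that by auto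
    moreover have "(x, y) \<in> R" using quotient_eq_iff[OF R that(1,1,2,3)] by simp
    ultimately show ?thesis using edge_iff by simp
  qed
  moreover have "{x, y} \<in> edges G" if "A \<in> ?P" "B \<in> ?P" "A \<noteq> B" "x \<in> A" "y \<in> B" for A B x y
  proof -
    have "x \<in> verts G" "y \<in> verts G"
      using in_quotient_imp_subset[OF R that(1)] in_quotient_imp_subset[OF R that(2)] that by auto
    moreover have "(x, y) \<notin> R" using quotient_eq_iff[OF R that(1,2,4,5)] that(3) by simp
    ultimately show ?thesis using edge_iff by simp
  qed
  ultimately have "complete_partite |?P| G"
    unfolding complete_partite_def
    by (intro conjI exI[of _ ?P] card_of_Card_order card_of_refl) auto
  then show ?thesis unfolding complete_multipartite_def by blast
qed

text \<open>Vertices in different parts are always adjacent, so non-adjacency forces a common part: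
  the part of \<open>z\<close> contains both \<open>x\<close> and \<open>y\<close>, and no edge lies
  inside a part.\<close>

lemma complete_multipartite_nonadjacent_trans:
  assumes "complete_multipartite G"
    and "x \<in> verts G" "y \<in> verts G" "z \<in> verts G"
    and "{x, z} \<notin> edges G" "{z, y} \<notin> edges G"
  shows "{x, y} \<notin> edges G"
proof -
  obtain P where P: "\<Union>P = verts G" "\<forall>A\<in>P. \<forall>u\<in>A. \<forall>v\<in>A. {u, v} \<notin> edges G"
    "\<forall>A\<in>P. \<forall>B\<in>P. A \<noteq> B \<longrightarrow> (\<forall>u\<in>A. \<forall>v\<in>B. {u, v} \<in> edges G)"
    using assms(1) unfolding complete_multipartite_def complete_partite_def partition_on_def
    by (elim exE conjE)
  obtain A B C where "A \<in> P" "x \<in> A" "B \<in> P" "y \<in> B" "C \<in> P" "z \<in> C"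
    using P(1) assms(2-4) by blast
  moreover from this have "A = C" "C = B" using P(3) assms(5,6) by blast+
  ultimately show ?thesis using P(2) by blast
qed

lemma verts_dist_graph: "verts (dist_graph X d r) = X"
  by (simp add: dist_graph_def)

text \<open>Covers \<open>u = v\<close> as well: there is no loop, and \<open>0 < r\<close> makes
  the right side false because the distance is zero. Later arguments thus need no case split on
  coincident points.\<close>

lemma dist_graph_edge_iff:
  assumes "Metric_space X d" "u \<in> X" "v \<in> X" "0 < r"
  shows "{u, v} \<in> edges (dist_graph X d r) \<longleftrightarrow> r \<le> ereal (d u v)"
proof (cases "u = v")
  case True
  then have "d u v = 0" using assms by (simp add: Metric_space.mdist_zero)
  with True assms(4) show ?thesis by (auto simp: dist_graph_def doubleton_eq_iff simp flip: zero_ereal_def)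
qed (use dist_graph_adjacent_iff[OF assms(1-3)] in simp)

text \<open>The classes are the open balls of radius \<open>r\<close>. Reflexivity comes from
  \<open>0 < r\<close>, symmetry from that of \<open>d\<close>, and transitivity from the
  ultrametric inequality.\<close>

lemma ultrametric_equiv_dist_less:
  assumes "ultrametric_space X d" "0 < r"
  shows "equiv X {(x, y). x \<in> X \<and> y \<in> X \<and> ereal (d x y) < r}"
proof (rule equivI)
  interpret Metric_space X d using assms(1) unfolding ultrametric_space_def by blast
  show "refl_on X {(x, y). x \<in> X \<and> y \<in> X \<and> ereal (d x y) < r}"
    using assms(2) by (auto intro!: refl_onI simp flip: zero_ereal_def)
  show "sym {(x, y). x \<in> X \<and> y \<in> X \<and> ereal (d x y) < r}"
    by (auto intro!: symI simp: commute)
  show "trans {(x, y). x \<in> X \<and> y \<in> X \<and> ereal (d x y) < r}"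
  proof (rule transI, clarsimp)
    fix x y z
    assume X: "x \<in> X" "y \<in> X" "z \<in> X" and less: "ereal (d x y) < r" "ereal (d y z) < r"
    have "d x z \<le> max (d x y) (d y z)"
      using assms(1) X unfolding ultrametric_space_def by blast
    then have "ereal (d x z) \<le> max (ereal (d x y)) (ereal (d y z))"
      by (simp add: le_max_iff_disj)
    also have "\<dots> < r" using less by simp
    finally show "ereal (d x z) < r" .
  qed
qed auto

theorem theorem3p13:
  fixes X :: "'a set" and d :: "'a \<Rightarrow> 'a \<Rightarrow> real"
  assumes "Metric_space X d"
    and "ctwo \<le>o |X|"
  shows "ultrametric_space X d \<longleftrightarrow>
    (\<forall>r\<in>{0<..ediam X d}. empty_graph (dist_graph X d r) \<or> complete_multipartite (dist_graph X d r))"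
proof
  assume ultra: "ultrametric_space X d"
  show "\<forall>r\<in>{0<..ediam X d}.
    empty_graph (dist_graph X d r) \<or> complete_multipartite (dist_graph X d r)"
  proof (intro ballI disj_imp[THEN iffD2] impI)
    fix r assume "r \<in> {0<..ediam X d}" and "\<not> empty_graph (dist_graph X d r)"
    \<comment> \<open>The ends of any edge are at distance at least \<open>r\<close>, hence lie in
      different balls; they witness that there are two parts.\<close>
    then obtain u v where r: "0 < r" and uv: "u \<in> X" "v \<in> X" "r \<le> ereal (d u v)"
      by (auto simp: empty_graph_def dist_graph_def)
    show "complete_multipartite (dist_graph X d r)"
    proof (rule complete_multipartiteI[where u = u and v = v], unfold verts_dist_graph)
      show "equiv X {(x, y). x \<in> X \<and> y \<in> X \<and> ereal (d x y) < r}"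
        by (rule ultrametric_equiv_dist_less[OF ultra r])
    qed (use uv dist_graph_edge_iff[OF assms(1) _ _ r] in auto)
  qed
next
  assume graphs: "\<forall>r\<in>{0<..ediam X d}.
    empty_graph (dist_graph X d r) \<or> complete_multipartite (dist_graph X d r)"
  have "d x y \<le> max (d x z) (d z y)" if X: "x \<in> X" "y \<in> X" "z \<in> X" for x y z
  proof (rule ccontr)
    assume "\<not> d x y \<le> max (d x z) (d z y)"
    then have less: "d x z < d x y" "d z y < d x y" by auto
    let ?G = "dist_graph X d (ereal (d x y))"
    have pos: "0 < ereal (d x y)"
      using less(1) Metric_space.nonneg[OF assms(1), of x z] by simp
    \<comment> \<open>The threshold is itself a distance in \<open>X\<close>, so it is bounded by
      the diameter and the hypothesis applies to it.\<close>
    have "ereal (d x y) \<le> ediam X d"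
      unfolding ediam_def by (rule SUP_upper2[of "(x, y)"]) (use X in auto)
    \<comment> \<open>This edge is used twice: it rules out the empty graph, and it contradicts the
      transitivity of non-adjacency through \<open>z\<close>.\<close>
    moreover have edge: "{x, y} \<in> edges ?G"
      using dist_graph_edge_iff[OF assms(1) X(1,2) pos] by simp
    ultimately have "complete_multipartite ?G"
      using graphs pos by (auto simp: empty_graph_def)
    moreover have "{x, z} \<notin> edges ?G" "{z, y} \<notin> edges ?G"
      using less X by (simp_all add: dist_graph_edge_iff[OF assms(1) _ _ pos])
    ultimately show False
      using complete_multipartite_nonadjacent_trans[of ?G x y z] X edge
      unfolding verts_dist_graph by blast
  qed
  then show "ultrametric_space X d" using assms(1) unfolding ultrametric_space_def by blast
qed

end
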